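(* Let $G$ be a semigroup (with identity) and let $A,B\subset G$. Write $A_1=A$, $A_0=G\setminus A$, $B_1=B$, $B_0=G\setminus B$, and for $h\in G$ and $C\subset G$ let $h^{-1}C=\{g\in G: hg\in C\}$. Suppose that for any $k\in\mathbb{N}$, any $g_1,\dots,g_k\in G$ and any $\epsilon_1,\dots,\epsilon_k\in\{0,1\}$, $$(g_1^{-1}A_{\epsilon_1})\cap\cdots\cap(g_k^{-1}A_{\epsilon_k})\neq\emptyset\iff (g_1^{-1}B_{\epsilon_1})\cap\cdots\cap(g_k^{-1}B_{\epsilon_k})\neq\emptyset.$$ Then $A$ and $B$ are isomorphic.
   Context: Semigroups are discrete and contain an identity element $e$. A topological dynamical $G$-system $(X,(T_g)_{g\in G})$ is a compact Hausdorff space $X$ with continuous maps $T_g:X\to X$ such that $T_{gh}=T_gT_h$ for all $g,h\in G$ and $T_e=\mathrm{id}_X$. A point $a\in X$ is transitive if $\{T_ga:g\in G\}$ is dense in $X$. For bounded $f:G\to\mathbb{C}$, a $G$-system $(X,(T_g))$ is a Furstenberg system of $f$ if there exist $F\in C(X)$ and a transitive point $a\in X$ with $f(g)=F(T_ga)$ for all $g\in G$, and for any $x\ne y$ in $X$ there is $g\in G$ with $F(T_gx)\neq F(T_gy)$. It is unique up to topological isomorphism (a homeomorphism $\phi$ with $\phi\circ T_g=S_g\circ\phi$ for all $g$). One realisation is the symbolic system: with $K=\overline{f(G)}$ and $R_g\big((x(u))_{u\in G}\big)=(x(ug))_{u\in G}$ on $K^G$ (product topology), it is $(X_{R,f},(R_g))$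 with $X_{R,f}=\overline{\{R_hf:h\in G\}}$. The Furstenberg system of a set $A\subset G$ is the Furstenberg system of its indicator function $\mathbb{1}_A:G\to\{0,1\}$. Two sets $A,B\subset G$ are isomorphic if their Furstenberg systems are topologically isomorphic. *)

theory Defs
  imports "HOL-Analysis.Analysis"
begin

text \<open>
  The acting semigroup with identity is a type of class \<open>monoid_mult\<close>. A system is
  an abstract topology \<open>X\<close> with carrier \<open>topspace X\<close>; the maps \<open>T g\<close> are
  relevant only on that carrier.
\<close>

definition dynamical_system ::
  "'x topology \<Rightarrow> ('g::monoid_mult \<Rightarrow> 'x \<Rightarrow> 'x) \<Rightarrow> bool" where
  "dynamical_system X T \<longleftrightarrow>
     compact_space X \<and> Hausdorff_space X \<and>
     (\<forall>g. continuous_map X X (T g)) \<and>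
     (\<forall>g h. \<forall>x\<in>topspace X. T (g * h) x = T g (T h x)) \<and>
     (\<forall>x\<in>topspace X. T 1 x = x)"

definition transitive_point ::
  "'x topology \<Rightarrow> ('g::monoid_mult \<Rightarrow> 'x \<Rightarrow> 'x) \<Rightarrow> 'x \<Rightarrow> bool" where
  "transitive_point X T a \<longleftrightarrow>
     a \<in> topspace X \<and> X closure_of (range (\<lambda>g. T g a)) = topspace X"

definition furstenberg_system ::
  "('g::monoid_mult \<Rightarrow> complex) \<Rightarrow> 'x topology \<Rightarrow> ('g \<Rightarrow> 'x \<Rightarrow> 'x) \<Rightarrow> bool" where
  "furstenberg_system f X T \<longleftrightarrow>
     bounded (range f) \<and> dynamical_system X T \<and>
     (\<exists>F a. continuous_map X euclidean F \<and> transitive_point X T a \<and>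
        (\<forall>g. f g = F (T g a)) \<and>
        (\<forall>x\<in>topspace X. \<forall>y\<in>topspace X. x \<noteq> y \<longrightarrow> (\<exists>g. F (T g x) \<noteq> F (T g y))))"

definition topologically_isomorphic ::
  "'x topology \<Rightarrow> ('g \<Rightarrow> 'x \<Rightarrow> 'x) \<Rightarrow> 'y topology \<Rightarrow> ('g \<Rightarrow> 'y \<Rightarrow> 'y) \<Rightarrow> bool" where
  "topologically_isomorphic X T Y S \<longleftrightarrow>
     (\<exists>\<phi>. homeomorphic_map X Y \<phi> \<and> (\<forall>g. \<forall>x\<in>topspace X. \<phi> (T g x) = S g (\<phi> x)))"

text \<open>
  A definition cannot quantify over all types, so the Furstenberg systems below are taken
  with points in \<open>'g \<Rightarrow> complex\<close>, the type housing the symbolic system. This is no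
  restriction: every bounded function has a Furstenberg system there
  (\<open>furstenberg_system_symbolic\<close>), and \<open>isomorphic_sets_iff\<close> shows that the notion may
  be tested on any Furstenberg systems of the two sets, over any types.
\<close>

definition isomorphic_sets :: "'g::monoid_mult set \<Rightarrow> 'g set \<Rightarrow> bool" where
  "isomorphic_sets A B \<longleftrightarrow>
     (\<exists>(X :: ('g \<Rightarrow> complex) topology) T (Y :: ('g \<Rightarrow> complex) topology) S.
        furstenberg_system (indicator A) X T \<and> furstenberg_system (indicator B) Y S \<and>
        topologically_isomorphic X T Y S)"

definition translate_preimage :: "'g::monoid_mult \<Rightarrow> 'g set \<Rightarrow> 'g set" where
  "translate_preimage h C = {g. h * g \<in> C}"

definition side :: "'g set \<Rightarrow> nat \<Rightarrow> 'g set" where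
  "side A \<epsilon> = (if \<epsilon> = 1 then A else - A)"

subsection \<open>The symbolic system; existence and uniqueness of Furstenberg systems\<close>

definition shift :: "'g::monoid_mult \<Rightarrow> ('g \<Rightarrow> complex) \<Rightarrow> 'g \<Rightarrow> complex" where
  "shift g x = (\<lambda>u. x (u * g))"

text \<open>
  The closure is taken in the product topology on all of \<open>'g \<Rightarrow> complex\<close>; it agrees
  with the closure in the closed subset \<open>K\<^sup>G\<close>, where \<open>K = closure (range f)\<close>.
\<close>

definition symbolic_space :: "('g::monoid_mult \<Rightarrow> complex) \<Rightarrow> ('g \<Rightarrow> complex) topology" where
  "symbolic_space f = top_of_set (closure (range (\<lambda>h. shift h f)))"

lemma shift_apply [simp]: "shift g x u = x (u * g)"
  by (simp add: shift_def)

lemma shift_one [simp]: "shift 1 x = x"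
  by (simp add: shift_def)

lemma shift_shift: "shift g (shift h x) = shift (g * h) x"
  by (simp add: shift_def mult.assoc)

lemma continuous_on_shift: "continuous_on S (shift g)"
  unfolding shift_def
  by (intro continuous_on_coordinatewise_then_product
      continuous_on_subset [OF continuous_on_product_coordinates subset_UNIV])

lemma Hausdorff_space_fun_complex: "Hausdorff_space (euclidean :: ('g \<Rightarrow> complex) topology)"
  by (simp add: euclidean_product_topology [symmetric] Hausdorff_space_product_topology)

lemma compact_symbolic:
  fixes f :: "'g::monoid_mult \<Rightarrow> complex"
  assumes "bounded (range f)"
  shows "compact (closure (range (\<lambda>h. shift h f)))"
proof -
  define K where "K = (\<Pi>\<^sub>E u\<in>(UNIV::'g set). closure (range f))"
  have "compact (closure (range f))"
    using assms by (simp add: compact_closure)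
  then have "compactin (product_topology (\<lambda>_::'g. euclidean) UNIV) K"
    unfolding K_def by (intro compactin_PiE [THEN iffD2]) auto
  then have K: "compactin euclidean K"
    by (simp add: euclidean_product_topology)
  then have "closedin euclidean K"
    using Hausdorff_space_fun_complex compactin_imp_closedin by blast
  moreover have "range (\<lambda>h. shift h f) \<subseteq> K"
    using closure_subset [of "range f"] by (auto simp: K_def shift_def)
  ultimately have "closure (range (\<lambda>h. shift h f)) \<subseteq> K"
    by (simp add: closure_minimal)
  then have "compactin euclidean (closure (range (\<lambda>h. shift h f)))"
    using K closed_compactin closed_closedin closed_closure by blast
  then show ?thesis by simp
qed

lemma shift_symbolic:
  assumes "x \<in> closure (range (\<lambda>h. shift h f))"
  shows "shift g x \<in> closure (range (\<lambda>h. shift h f))"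
proof -
  have "shift g ` closure (range (\<lambda>h. shift h f)) \<subseteq> closure (range (\<lambda>h. shift h f))"
  proof (rule image_closure_subset [OF continuous_on_shift closed_closure])
    show "shift g ` range (\<lambda>h. shift h f) \<subseteq> closure (range (\<lambda>h. shift h f))"
      using closure_subset [of "range (\<lambda>h. shift h f)"] by (auto simp: shift_shift)
  qed
  with assms show ?thesis by blast
qed

theorem furstenberg_system_symbolic:
  fixes f :: "'g::monoid_mult \<Rightarrow> complex"
  assumes "bounded (range f)"
  shows "furstenberg_system f (symbolic_space f) shift"
proof -
  let ?C = "closure (range (\<lambda>h. shift h f))"
  have f: "range (\<lambda>h. shift h f) \<subseteq> ?C"
    by (rule closure_subset)
  have "dynamical_system (symbolic_space f) shift"
    unfolding dynamical_system_def symbolic_space_def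
    using compact_symbolic [OF assms] shift_symbolic [of _ f]
    by (auto simp: compact_space_subtopology Hausdorff_space_subtopology
        Hausdorff_space_fun_complex continuous_on_shift shift_shift)
  moreover have "transitive_point (symbolic_space f) shift f"
  proof -
    have "f \<in> ?C"
      using f shift_one [of f] by (metis rangeI subsetD)
    moreover have "symbolic_space f closure_of (range (\<lambda>h. shift h f)) = ?C"
      using f by (simp add: symbolic_space_def closure_of_subtopology Int_absorb1)
    ultimately show ?thesis
      by (simp add: transitive_point_def symbolic_space_def)
  qed
  moreover have "continuous_map (symbolic_space f) euclidean (\<lambda>x. x 1)"
    unfolding symbolic_space_def continuous_map_iff_continuous
    by (rule continuous_on_subset [OF continuous_on_product_coordinates subset_UNIV])
  ultimately show ?thesis
    unfolding furstenberg_system_def using assms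
    by (intro conjI exI [of _ "\<lambda>x. x 1"] exI [of _ f]) (auto simp: fun_eq_iff)
qed

lemma topologically_isomorphic_sym:
  assumes T: "dynamical_system X T" and "topologically_isomorphic X T Y S"
  shows "topologically_isomorphic Y S X T"
proof -
  obtain \<phi> where \<phi>: "homeomorphic_map X Y \<phi>"
    and eq: "\<And>g x. x \<in> topspace X \<Longrightarrow> \<phi> (T g x) = S g (\<phi> x)"
    using assms unfolding topologically_isomorphic_def by blast
  obtain \<psi> where \<psi>: "homeomorphic_maps X Y \<phi> \<psi>"
    using \<phi> homeomorphic_map_maps by blast
  have T': "T g x \<in> topspace X" if "x \<in> topspace X" for g x
    using T that by (auto simp: dynamical_system_def continuous_map_def)
  have "\<psi> (S g y) = T g (\<psi> y)" if "y \<in> topspace Y" for g y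
  proof -
    have "\<psi> y \<in> topspace X" "\<phi> (\<psi> y) = y"
      using \<psi> that by (auto simp: homeomorphic_maps_def continuous_map_def)
    then show ?thesis
      using eq [of "\<psi> y" g] T' \<psi> by (metis homeomorphic_maps_def)
  qed
  moreover have "homeomorphic_map Y X \<psi>"
    using \<psi> homeomorphic_maps_map homeomorphic_maps_sym by blast
  ultimately show ?thesis
    unfolding topologically_isomorphic_def by blast
qed

lemma topologically_isomorphic_trans:
  assumes "topologically_isomorphic X T Y S" "topologically_isomorphic Y S Z R"
  shows "topologically_isomorphic X T Z R"
proof -
  obtain \<phi> \<psi> where \<phi>: "homeomorphic_map X Y \<phi>" "homeomorphic_map Y Z \<psi>"
    and eq: "\<And>g x. x \<in> topspace X \<Longrightarrow> \<phi> (T g x) = S g (\<phi> x)"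
      "\<And>g y. y \<in> topspace Y \<Longrightarrow> \<psi> (S g y) = R g (\<psi> y)"
    using assms unfolding topologically_isomorphic_def by blast
  have "\<phi> x \<in> topspace Y" if "x \<in> topspace X" for x
    using \<phi>(1) that by (metis homeomorphic_imp_surjective_map imageI)
  with eq \<phi> show ?thesis
    unfolding topologically_isomorphic_def
    by (intro exI [of _ "\<psi> \<circ> \<phi>"]) (simp add: homeomorphic_map_compose)
qed

lemma topologically_isomorphic_symbolic:
  assumes "furstenberg_system f X T"
  shows "topologically_isomorphic X T (symbolic_space f) shift"
proof -
  obtain F a where F: "continuous_map X euclidean F" and a: "transitive_point X T a"
    and fF: "\<And>g. f g = F (T g a)"
    and sep': "\<forall>x\<in>topspace X. \<forall>y\<in>topspace X. x \<noteq> y \<longrightarrow> (\<exists>g. F (T g x) \<noteq> F (T g y))"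
    using assms unfolding furstenberg_system_def by (elim conjE exE) metis
  have sep: "x = y" if "x \<in> topspace X" "y \<in> topspace X" "\<And>g. F (T g x) = F (T g y)" for x y
    using sep' that by meson
  have T: "dynamical_system X T"
    using assms by (simp add: furstenberg_system_def)
  define \<phi> where "\<phi> x = (\<lambda>u. F (T u x))" for x
  let ?O = "range (\<lambda>g. T g a)"
  let ?C = "closure (range (\<lambda>h. shift h f))"
  have mult: "T (g * h) x = T g (T h x)" if "x \<in> topspace X" for g h x
    using T that by (simp add: dynamical_system_def)
  have aX: "a \<in> topspace X" and dense: "X closure_of ?O = topspace X"
    using a by (simp_all add: transitive_point_def)
  have "continuous_map X (product_topology (\<lambda>_. euclidean) UNIV) \<phi>"
    unfolding continuous_map_componentwise_UNIV
  proof
    fix u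
    have "continuous_map X euclidean (F \<circ> T u)"
      using T F by (meson continuous_map_compose dynamical_system_def)
    then show "continuous_map X euclidean (\<lambda>x. \<phi> x u)"
      by (simp add: \<phi>_def o_def)
  qed
  then have cont: "continuous_map X euclidean \<phi>"
    by (simp add: euclidean_product_topology)
  have equi: "\<phi> (T g x) = shift g (\<phi> x)" if "x \<in> topspace X" for g x
    using mult [OF that] by (simp add: \<phi>_def shift_def)
  have "\<phi> a = f"
    using fF by (simp add: \<phi>_def fun_eq_iff)
  then have orbit: "\<phi> ` ?O = range (\<lambda>h. shift h f)"
    using equi [OF aX] by (simp add: image_image)
  have img: "\<phi> ` topspace X = ?C"
  proof
    show "\<phi> ` topspace X \<subseteq> ?C"
      using continuous_map_image_closure_subset [OF cont, of ?O] dense orbit by simp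
    have "compactin euclidean (\<phi> ` topspace X)"
      using T cont by (meson compact_space_def dynamical_system_def image_compactin)
    then have "closedin euclidean (\<phi> ` topspace X)"
      using Hausdorff_space_fun_complex compactin_imp_closedin by blast
    moreover have "range (\<lambda>h. shift h f) \<subseteq> \<phi> ` topspace X"
    proof -
      have "?O \<subseteq> topspace X"
        using T aX by (auto simp: dynamical_system_def continuous_map_def)
      then show ?thesis using orbit by blast
    qed
    ultimately show "?C \<subseteq> \<phi> ` topspace X"
      by (simp add: closure_minimal)
  qed
  have "homeomorphic_map X (symbolic_space f) \<phi>"
  proof (rule continuous_imp_homeomorphic_map)
    show "compact_space X"
      using T by (simp add: dynamical_system_def)
    show "Hausdorff_space (symbolic_space f)"
      by (simp add: symbolic_space_def Hausdorff_space_subtopology Hausdorff_space_fun_complex)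
    show "continuous_map X (symbolic_space f) \<phi>"
      using cont img by (auto simp: symbolic_space_def continuous_map_in_subtopology)
    show "\<phi> ` topspace X = topspace (symbolic_space f)"
      using img by (simp add: symbolic_space_def)
    show "inj_on \<phi> (topspace X)"
      using sep by (auto simp: inj_on_def \<phi>_def fun_eq_iff)
  qed
  with equi show ?thesis
    unfolding topologically_isomorphic_def by blast
qed

theorem furstenberg_system_unique:
  assumes "furstenberg_system f X T" "furstenberg_system f Y S"
  shows "topologically_isomorphic X T Y S"
proof (rule topologically_isomorphic_trans)
  show "topologically_isomorphic X T (symbolic_space f) shift"
    using assms(1) by (rule topologically_isomorphic_symbolic)
  have "dynamical_system Y S"
    using assms(2) by (simp add: furstenberg_system_def)
  then show "topologically_isomorphic (symbolic_space f) shift Y S"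
    using topologically_isomorphic_symbolic [OF assms(2)]
    by (rule topologically_isomorphic_sym)
qed

theorem isomorphic_sets_iff:
  assumes X: "furstenberg_system (indicator A) X T" and Y: "furstenberg_system (indicator B) Y S"
  shows "isomorphic_sets A B \<longleftrightarrow> topologically_isomorphic X T Y S"
proof
  assume "isomorphic_sets A B"
  then obtain X' Y' :: "('a \<Rightarrow> complex) topology" and T' S' where "furstenberg_system (indicator A) X' T'"
    "furstenberg_system (indicator B) Y' S'" "topologically_isomorphic X' T' Y' S'"
    unfolding isomorphic_sets_def by blast
  then show "topologically_isomorphic X T Y S"
    by (meson furstenberg_system_unique X Y topologically_isomorphic_trans)
next
  assume iso: "topologically_isomorphic X T Y S"
  have A: "furstenberg_system (indicator A) (symbolic_space (indicator A)) shift"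
    and B: "furstenberg_system (indicator B) (symbolic_space (indicator B)) shift"
    using X Y furstenberg_system_symbolic by (auto simp: furstenberg_system_def)
  show "isomorphic_sets A B"
    unfolding isomorphic_sets_def
    by (intro exI conjI, rule A, rule B)
       (rule topologically_isomorphic_trans [OF furstenberg_system_unique [OF A X]
          topologically_isomorphic_trans [OF iso furstenberg_system_unique [OF Y B]]])
qed

end

theory Submission
  imports Defs
begin

text \<open>
  A basic neighbourhood of a point of \<open>{0,1}\<^sup>G\<close> prescribes finitely many coordinates, and
  \<open>(g\<^sub>1\<^sup>-\<^sup>1 A\<^bsub>\<epsilon>\<^sub>1\<^esub>) \<inter> \<dots> \<inter> (g\<^sub>k\<^sup>-\<^sup>1 A\<^bsub>\<epsilon>\<^sub>k\<^esub>)\<close> consists of those \<open>h\<close> for which the shift of the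
  indicator of \<open>A\<close> by \<open>h\<close> takes the value \<open>\<epsilon>\<^sub>i\<close> at \<open>g\<^sub>i\<close> for all \<open>i\<close>. So the hypothesis says
  that the orbits of the two indicators meet the same basic open sets. They then have the same
  closure: the two symbolic systems are not merely isomorphic but equal.
\<close>

text \<open>A basic open set of the product constrains only finitely many coordinates, so exact
  agreement on those suffices, whatever the topology on the values.\<close>

lemma closure_funI:
  fixes x :: "'a \<Rightarrow> 'b::topological_space"
  assumes "\<And>I. finite I \<Longrightarrow> \<exists>y\<in>S. \<forall>i\<in>I. y i = x i"
  shows "x \<in> closure S"
  unfolding closure_iff_nhds_not_empty
proof (intro allI impI)
  fix A U :: "('a \<Rightarrow> 'b) set"
  assume "U \<subseteq> A" "open U" "x \<in> U"
  then obtain V where V: "x \<in> Pi\<^sub>E UNIV V" "finite {i. V i \<noteq> UNIV}" "Pi\<^sub>E UNIV V \<subseteq> U"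
    using product_topology_open_contains_basis [of "\<lambda>_. euclidean" UNIV U x]
    by (auto simp: euclidean_product_topology)
  obtain y where "y \<in> S" and y: "\<forall>i\<in>{i. V i \<noteq> UNIV}. y i = x i"
    using assms [OF V(2)] by blast
  have "y i \<in> V i" for i
    using y V(1) by (cases "V i = UNIV") auto
  with V(3) \<open>U \<subseteq> A\<close> \<open>y \<in> S\<close> show "S \<inter> A \<noteq> {}"
    by auto
qed

lemma mem_side_indicator_iff: "u \<in> side A (indicator B v) \<longleftrightarrow> (u \<in> A \<longleftrightarrow> v \<in> B)"
  by (simp add: side_def indicator_def)

text \<open>One direction of the equivalence gives one inclusion; the theorem uses this twice, with
  \<open>A\<close> and \<open>B\<close> exchanged.\<close>

lemma closure_shift_indicator_subset:
  fixes A B :: "'g::monoid_mult set"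
  assumes "\<And>(k::nat) (g :: nat \<Rightarrow> 'g) (\<epsilon> :: nat \<Rightarrow> nat).
      \<lbrakk>k \<ge> 1; \<forall>i\<in>{1..k}. \<epsilon> i \<in> {0, 1};
       (\<Inter>i\<in>{1..k}. translate_preimage (g i) (side A (\<epsilon> i))) \<noteq> {}\<rbrakk> \<Longrightarrow>
      (\<Inter>i\<in>{1..k}. translate_preimage (g i) (side B (\<epsilon> i))) \<noteq> {}"
  shows "closure (range (\<lambda>h. shift h (indicator A :: 'g \<Rightarrow> complex)))
    \<subseteq> closure (range (\<lambda>h. shift h (indicator B)))"
\<comment> \<open>The right-hand side is closed, so only orbit points need approximating.\<close>
proof (rule closure_minimal [OF _ closed_closure], rule image_subsetI, rule closure_funI)
  fix h and I :: "'g set"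
  assume "finite I"
  \<comment> \<open>Adding \<open>1\<close> to \<open>I\<close> keeps the number of constraints
    positive even when \<open>I\<close> is empty.\<close>
  then obtain g where g: "bij_betw g {1..card (insert 1 I)} (insert 1 I)"
    using ex_bij_betw_nat_finite_1 by blast
  \<comment> \<open>\<open>\<epsilon>\<close> records the pattern of \<open>A\<close> seen from
    \<open>h\<close>, so \<open>h\<close> itself witnesses nonemptiness for
    \<open>A\<close>.\<close>
  define \<epsilon> :: "nat \<Rightarrow> nat" where "\<epsilon> i = indicator A (g i * h)" for i
  let ?k = "card (insert 1 I)"
  have "h \<in> (\<Inter>i\<in>{1..?k}. translate_preimage (g i) (side A (\<epsilon> i)))"
    by (simp add: translate_preimage_def mem_side_indicator_iff \<epsilon>_def)
  moreover have "?k \<ge> 1" "\<forall>i\<in>{1..?k}. \<epsilon> i \<in> {0, 1}"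
    using \<open>finite I\<close> by (auto simp: \<epsilon>_def indicator_def card_insert_if Suc_le_eq card_gt_0_iff)
  ultimately obtain h' where h': "h' \<in> (\<Inter>i\<in>{1..?k}. translate_preimage (g i) (side B (\<epsilon> i)))"
    using assms [of ?k \<epsilon> g] by blast
  have "u * h' \<in> B \<longleftrightarrow> u * h \<in> A" if "u \<in> I" for u
  proof -
    have "u \<in> g ` {1..?k}"
      using that unfolding bij_betw_imp_surj_on [OF g] by simp
    then obtain i where "i \<in> {1..?k}" "u = g i"
      by blast
    then show ?thesis
      using h' by (auto simp: translate_preimage_def mem_side_indicator_iff \<epsilon>_def)
  qed
  then show "\<exists>y\<in>range (\<lambda>h. shift h (indicator B :: 'g \<Rightarrow> complex)).
      \<forall>u\<in>I. y u = shift h (indicator A) u"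
    by (intro bexI [of _ "shift h' (indicator B)"]) (auto simp: indicator_def)
qed

theorem proposition1p4:
  fixes A B :: "'g::monoid_mult set"
  assumes "\<And>(k::nat) (g :: nat \<Rightarrow> 'g) (\<epsilon> :: nat \<Rightarrow> nat).
      \<lbrakk>k \<ge> 1; \<forall>i\<in>{1..k}. \<epsilon> i \<in> {0, 1}\<rbrakk> \<Longrightarrow>
      (\<Inter>i\<in>{1..k}. translate_preimage (g i) (side A (\<epsilon> i))) \<noteq> {} \<longleftrightarrow>
      (\<Inter>i\<in>{1..k}. translate_preimage (g i) (side B (\<epsilon> i))) \<noteq> {}"
  shows "isomorphic_sets A B"
proof -
  have "closure (range (\<lambda>h. shift h (indicator A :: 'g \<Rightarrow> complex)))
      = closure (range (\<lambda>h. shift h (indicator B)))"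
    by (intro equalityI closure_shift_indicator_subset) (simp_all only: assms not_False_eq_True)
  then have eq: "symbolic_space (indicator A :: 'g \<Rightarrow> complex) = symbolic_space (indicator B)"
    by (simp add: symbolic_space_def)
  \<comment> \<open>Indicators are bounded, so isomorphism can be tested on the symbolic
    systems.\<close>
  have F: "furstenberg_system (indicator C) (symbolic_space (indicator C)) shift" for C :: "'g set"
  proof (rule furstenberg_system_symbolic, rule finite_imp_bounded)
    have "range (indicator C :: 'g \<Rightarrow> complex) \<subseteq> {0, 1}"
      by (auto simp: indicator_def)
    then show "finite (range (indicator C :: 'g \<Rightarrow> complex))"
      by (rule finite_subset) simp
  qed
  have "topologically_isomorphic (symbolic_space (indicator A :: 'g \<Rightarrow> complex)) shift
      (symbolic_space (indicator B)) shift"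
    unfolding topologically_isomorphic_def by (rule exI [of _ id]) (simp add: eq)
  then show ?thesis
    by (simp add: isomorphic_sets_iff [OF F F])
qed

end
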